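(* The class of Weyl Finsler metrics is a proper subset of the class of generalized weakly-Weyl Finsler metrics. That is, every Weyl metric is a generalized weakly-Weyl Finsler metric, and there exists a generalized weakly-Weyl Finsler metric (on some manifold) that is not a Weyl metric.
   Context: Let $M$ be an $n$-dimensional smooth manifold. A Finsler metric on $M$ is a non-negative function $F$ on $TM$ that is $C^\infty$ on $TM_0=TM\setminus\{0\}$, positively homogeneous of degree one in $y$, and such that $g_{ij}=\frac12\frac{\partial^2F^2}{\partial y^i\partial y^j}$ is positive definite at every $y\neq 0$. Its spray coefficients are $G^i(x,y)=\frac14 g^{il}\left\{\frac{\partial^2F^2}{\partial x^k\partial y^l}y^k-\frac{\partial F^2}{\partial x^l}\right\}$. Notation: "$._k$" denotes $\partial/\partial y^k$; "$|_m$" denotes the horizontal covariant derivative with respect to the Berwald connection of $F$, e.g. $T^i{}_{j|m}=\frac{\partial T^i{}_j}{\partial x^m}-G^r{}_{.m}T^i{}_{j.r}+T^r{}_jG^i{}_{.r.m}-T^i{}_rG^r{}_{.j.m}$, and similarly for other tensors on $TM_0$. A subscript $0$ denotes contraction with $y$: $T_{|0}=T_{|m}y^m$. The Riemann curvature is $R^i{}_k=2\frac{\partial G^i}{\partial x^k}-\frac{\partial^2G^i}{\partial x^m\partial y^k}y^m+2G^m\frac{\partial^2G^i}{\partial y^m\partial y^k}-\frac{\partial G^i}{\partial y^m}\frac{\partial G^m}{\partial y^k}$. The Weyl curvature is $W^i{}_k=A^i{}_k-\frac1{n+1}A^m{}_{k.m}y^i$, where $A^i{}_k=R^i{}_k-R\,\delta^i{}_k$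 and $R=\frac1{n-1}R^m{}_m$. $F$ is a Weyl metric if $W^i{}_k=0$. Put $W_j{}^i{}_{kl}=\frac13\left(W^i{}_{k.l}-W^i{}_{l.k}\right)_{.j}$ and $\tilde W_j{}^i{}_{kl}=W_j{}^i{}_{ml.k}y^m$ (that is, $y^m\,\partial W_j{}^i{}_{ml}/\partial y^k$). $F$ is a generalized weakly-Weyl Finsler metric if $\tilde W_j{}^i{}_{kl|0}+\lambda F\tilde W_j{}^i{}_{kl}=\mu_r\tilde W_j{}^r{}_{kl}y^i$ for some tensor $\mu_r$ and some smooth scalar function $\lambda$ on $TM$. *)

theory Defs
  imports "HOL-Analysis.Analysis"
begin

section \<open>Smooth functions on open subsets of Euclidean m-space\<close>

text \<open>Points of m-dimensional space are the elements of \<^term>\<open>topspace (Euclidean_space m)\<close>: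
  functions on the naturals vanishing from index m on.  Coordinates are numbered from 0.\<close>

definition partial :: "nat \<Rightarrow> ((nat \<Rightarrow> real) \<Rightarrow> real) \<Rightarrow> (nat \<Rightarrow> real) \<Rightarrow> real" where
  "partial i f x = deriv (\<lambda>t. f (x(i := t))) (x i)"

text \<open>All iterated partial derivatives exist and are continuous on S.  Meant for S open in
  \<^term>\<open>Euclidean_space m\<close>; the values of f outside S are then irrelevant.\<close>

definition smooth_on :: "nat \<Rightarrow> (nat \<Rightarrow> real) set \<Rightarrow> ((nat \<Rightarrow> real) \<Rightarrow> real) \<Rightarrow> bool" where
  "smooth_on m S f \<longleftrightarrow>
     (\<forall>is. set is \<subseteq> {..<m} \<longrightarrow>
        continuous_on S (foldr partial is f) \<and>
        (\<forall>x\<in>S. \<forall>i<m. (\<lambda>t. foldr partial is f (x(i := t))) differentiable (at (x i))))"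


section \<open>Smooth manifolds\<close>

type_synonym 'a chart = "'a set \<times> ('a \<Rightarrow> nat \<Rightarrow> real)"

abbreviation chart_image :: "'a chart \<Rightarrow> (nat \<Rightarrow> real) set" where
  "chart_image c \<equiv> snd c ` fst c"

abbreviation chart_inv :: "'a chart \<Rightarrow> (nat \<Rightarrow> real) \<Rightarrow> 'a" where
  "chart_inv c \<equiv> inv_into (fst c) (snd c)"

text \<open>The atlas A is not required to be maximal: every smooth atlas determines a unique
  smooth structure.\<close>

definition smooth_manifold :: "nat \<Rightarrow> 'a topology \<Rightarrow> 'a chart set \<Rightarrow> bool" where
  "smooth_manifold n M A \<longleftrightarrow>
     Hausdorff_space M \<and> second_countable M \<and> (\<Union>c\<in>A. fst c) = topspace M \<and>
     (\<forall>c\<in>A. openin M (fst c) \<and> openin (Euclidean_space n) (chart_image c) \<and>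
        homeomorphic_map (subtopology M (fst c))
          (subtopology (Euclidean_space n) (chart_image c)) (snd c)) \<and>
     (\<forall>c\<in>A. \<forall>d\<in>A. \<forall>i<n.
        smooth_on n (snd c ` (fst c \<inter> fst d)) (\<lambda>x. snd d (chart_inv c x) i))"

definition smooth_functions :: "nat \<Rightarrow> 'a chart set \<Rightarrow> ('a \<Rightarrow> real) set" where
  "smooth_functions n A = {f. \<forall>c\<in>A. smooth_on n (chart_image c) (f \<circ> chart_inv c)}"


section \<open>The tangent bundle\<close>

text \<open>Tangent vectors at p are derivations at p of the algebra of smooth functions,
  normalised to be 0 on functions that are not smooth.\<close>

type_synonym 'a tvec = "('a \<Rightarrow> real) \<Rightarrow> real"

definition tangent_space :: "nat \<Rightarrow> 'a chart set \<Rightarrow> 'a \<Rightarrow> 'a tvec set" where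
  "tangent_space n A p =
     {D. (\<forall>f. f \<notin> smooth_functions n A \<longrightarrow> D f = 0) \<and>
         (\<forall>f\<in>smooth_functions n A. \<forall>g\<in>smooth_functions n A.
            (\<forall>a b. D (\<lambda>q. a * f q + b * g q) = a * D f + b * D g) \<and>
            D (\<lambda>q. f q * g q) = D f * g p + f p * D g)}"

definition tangent_bundle :: "nat \<Rightarrow> 'a chart set \<Rightarrow> ('a \<times> 'a tvec) set" where
  "tangent_bundle n A = (SIGMA p : (\<Union>c\<in>A. fst c). tangent_space n A p)"

definition slit_tangent_bundle :: "nat \<Rightarrow> 'a chart set \<Rightarrow> ('a \<times> 'a tvec) set" where
  "slit_tangent_bundle n A = {(p, D) \<in> tangent_bundle n A. D \<noteq> (\<lambda>f. 0)}"

text \<open>The coordinate vector \<open>\<partial>/\<partial>x\<^sup>i\<close> of the chart c at p.\<close>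

definition coord_vec :: "nat \<Rightarrow> 'a chart set \<Rightarrow> 'a chart \<Rightarrow> 'a \<Rightarrow> nat \<Rightarrow> 'a tvec" where
  "coord_vec n A c p i =
     (\<lambda>f. if f \<in> smooth_functions n A then partial i (f \<circ> chart_inv c) (snd c p) else 0)"

text \<open>The coordinates \<open>(x, y)\<close> induced by c on the tangent bundle are
  written as a single point z of 2n-space, with \<open>x\<^sup>i = z i\<close> and
  \<open>y\<^sup>i = z (n + i)\<close> for \<open>i < n\<close>.  Hence \<open>\<partial>/\<partial>x\<^sup>i\<close> is \<^term>\<open>partial i\<close>, and
  \<open>\<partial>/\<partial>y\<^sup>i\<close> is \<^term>\<open>partial (n + i)\<close>.\<close>

definition base_coords :: "nat \<Rightarrow> (nat \<Rightarrow> real) \<Rightarrow> nat \<Rightarrow> real" where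
  "base_coords n z = (\<lambda>i. if i < n then z i else 0)"

definition bundle_point :: "nat \<Rightarrow> 'a chart set \<Rightarrow> 'a chart \<Rightarrow> (nat \<Rightarrow> real) \<Rightarrow> 'a \<times> 'a tvec" where
  "bundle_point n A c z =
     (let p = chart_inv c (base_coords n z)
      in (p, \<lambda>f. \<Sum>i<n. z (n + i) * coord_vec n A c p i f))"

definition TM_coords :: "nat \<Rightarrow> 'a chart \<Rightarrow> (nat \<Rightarrow> real) set" where
  "TM_coords n c = {z \<in> topspace (Euclidean_space (2 * n)). base_coords n z \<in> chart_image c}"

definition TM0_coords :: "nat \<Rightarrow> 'a chart \<Rightarrow> (nat \<Rightarrow> real) set" where
  "TM0_coords n c = {z \<in> TM_coords n c. \<exists>i<n. z (n + i) \<noteq> 0}"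


section \<open>Coordinate expressions\<close>

text \<open>In this section L is the coordinate expression of a Finsler metric F in a chart.\<close>

definition fundamental_tensor ::
    "nat \<Rightarrow> ((nat \<Rightarrow> real) \<Rightarrow> real) \<Rightarrow> nat \<Rightarrow> nat \<Rightarrow> (nat \<Rightarrow> real) \<Rightarrow> real" where
  "fundamental_tensor n L i j z = 1/2 * partial (n + i) (partial (n + j) (\<lambda>z. (L z)\<^sup>2)) z"

text \<open>The inverse matrix \<open>g\<^sup>i\<^sup>j\<close>; the indices range over \<open>{..<n}\<close>, and
  the entries outside this range are set to 0 to make it unique.\<close>

definition inverse_tensor ::
    "nat \<Rightarrow> ((nat \<Rightarrow> real) \<Rightarrow> real) \<Rightarrow> nat \<Rightarrow> nat \<Rightarrow> (nat \<Rightarrow> real) \<Rightarrow> real" where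
  "inverse_tensor n L i j z =
     (THE h. (\<forall>i j. n \<le> i \<or> n \<le> j \<longrightarrow> h i j = 0) \<and>
             (\<forall>i<n. \<forall>j<n. (\<Sum>l<n. h i l * fundamental_tensor n L l j z) = of_bool (i = j))) i j"

definition spray ::
    "nat \<Rightarrow> ((nat \<Rightarrow> real) \<Rightarrow> real) \<Rightarrow> nat \<Rightarrow> (nat \<Rightarrow> real) \<Rightarrow> real" where
  "spray n L i z =
     1/4 * (\<Sum>l<n. inverse_tensor n L i l z *
        ((\<Sum>k<n. partial k (partial (n + l) (\<lambda>z. (L z)\<^sup>2)) z * z (n + k))
         - partial l (\<lambda>z. (L z)\<^sup>2) z))"

definition riemann ::
    "nat \<Rightarrow> ((nat \<Rightarrow> real) \<Rightarrow> real) \<Rightarrow> nat \<Rightarrow> nat \<Rightarrow> (nat \<Rightarrow> real) \<Rightarrow> real" where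
  "riemann n L i k z =
     2 * partial k (spray n L i) z
     - (\<Sum>m<n. partial m (partial (n + k) (spray n L i)) z * z (n + m))
     + 2 * (\<Sum>m<n. spray n L m z * partial (n + m) (partial (n + k) (spray n L i)) z)
     - (\<Sum>m<n. partial (n + m) (spray n L i) z * partial (n + k) (spray n L m) z)"

definition ricci_scalar ::
    "nat \<Rightarrow> ((nat \<Rightarrow> real) \<Rightarrow> real) \<Rightarrow> (nat \<Rightarrow> real) \<Rightarrow> real" where
  "ricci_scalar n L z = 1 / (real n - 1) * (\<Sum>m<n. riemann n L m m z)"

definition A_tensor ::
    "nat \<Rightarrow> ((nat \<Rightarrow> real) \<Rightarrow> real) \<Rightarrow> nat \<Rightarrow> nat \<Rightarrow> (nat \<Rightarrow> real) \<Rightarrow> real" where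
  "A_tensor n L i k z = riemann n L i k z - ricci_scalar n L z * of_bool (i = k)"

definition weyl ::
    "nat \<Rightarrow> ((nat \<Rightarrow> real) \<Rightarrow> real) \<Rightarrow> nat \<Rightarrow> nat \<Rightarrow> (nat \<Rightarrow> real) \<Rightarrow> real" where
  "weyl n L i k z =
     A_tensor n L i k z
     - 1 / (real n + 1) * (\<Sum>m<n. partial (n + m) (A_tensor n L m k) z) * z (n + i)"

text \<open>\<open>weyl4 n L j i k l\<close> is \<open>W\<^sub>j\<^sup>i\<^sub>k\<^sub>l\<close>, and likewise for \<open>weyl_tilde\<close>.\<close>

definition weyl4 ::
    "nat \<Rightarrow> ((nat \<Rightarrow> real) \<Rightarrow> real) \<Rightarrow> nat \<Rightarrow> nat \<Rightarrow> nat \<Rightarrow> nat \<Rightarrow> (nat \<Rightarrow> real) \<Rightarrow> real" where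
  "weyl4 n L j i k l =
     partial (n + j)
       (\<lambda>z. 1/3 * (partial (n + l) (weyl n L i k) z - partial (n + k) (weyl n L i l) z))"

definition weyl_tilde ::
    "nat \<Rightarrow> ((nat \<Rightarrow> real) \<Rightarrow> real) \<Rightarrow> nat \<Rightarrow> nat \<Rightarrow> nat \<Rightarrow> nat \<Rightarrow> (nat \<Rightarrow> real) \<Rightarrow> real" where
  "weyl_tilde n L j i k l z = (\<Sum>m<n. z (n + m) * partial (n + k) (weyl4 n L j i m l) z)"

text \<open>\<open>hcov n L T j i k l m\<close> is the horizontal Berwald derivative \<open>T\<^sub>j\<^sup>i\<^sub>k\<^sub>l\<close>\<open>\<^sub>|\<^sub>m\<close> of a tensor
  with one contravariant index i and covariant indices j, k, l.\<close>

definition berwald ::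
    "nat \<Rightarrow> ((nat \<Rightarrow> real) \<Rightarrow> real) \<Rightarrow> nat \<Rightarrow> nat \<Rightarrow> nat \<Rightarrow> (nat \<Rightarrow> real) \<Rightarrow> real" where
  "berwald n L i r m = partial (n + m) (partial (n + r) (spray n L i))"

definition hcov ::
    "nat \<Rightarrow> ((nat \<Rightarrow> real) \<Rightarrow> real)
      \<Rightarrow> (nat \<Rightarrow> nat \<Rightarrow> nat \<Rightarrow> nat \<Rightarrow> (nat \<Rightarrow> real) \<Rightarrow> real)
      \<Rightarrow> nat \<Rightarrow> nat \<Rightarrow> nat \<Rightarrow> nat \<Rightarrow> nat \<Rightarrow> (nat \<Rightarrow> real) \<Rightarrow> real" where
  "hcov n L T j i k l m z =
     partial m (T j i k l) z
     - (\<Sum>r<n. partial (n + m) (spray n L r) z * partial (n + r) (T j i k l) z)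
     + (\<Sum>r<n. T j r k l z * berwald n L i r m z)
     - (\<Sum>r<n. T r i k l z * berwald n L r j m z)
     - (\<Sum>r<n. T j i r l z * berwald n L r k m z)
     - (\<Sum>r<n. T j i k r z * berwald n L r l m z)"

definition weyl_tilde_hcov0 ::
    "nat \<Rightarrow> ((nat \<Rightarrow> real) \<Rightarrow> real) \<Rightarrow> nat \<Rightarrow> nat \<Rightarrow> nat \<Rightarrow> nat \<Rightarrow> (nat \<Rightarrow> real) \<Rightarrow> real" where
  "weyl_tilde_hcov0 n L j i k l z = (\<Sum>m<n. hcov n L (weyl_tilde n L) j i k l m z * z (n + m))"


section \<open>Classes of Finsler metrics\<close>

definition finsler_metric :: "nat \<Rightarrow> 'a chart set \<Rightarrow> ('a \<times> 'a tvec \<Rightarrow> real) \<Rightarrow> bool" where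
  "finsler_metric n A F \<longleftrightarrow>
     (\<forall>v \<in> tangent_bundle n A. 0 \<le> F v) \<and>
     (\<forall>(p, D) \<in> tangent_bundle n A. \<forall>a>0. F (p, \<lambda>f. a * D f) = a * F (p, D)) \<and>
     (\<forall>c\<in>A. smooth_on (2 * n) (TM0_coords n c) (F \<circ> bundle_point n A c)) \<and>
     (\<forall>c\<in>A. \<forall>z\<in>TM0_coords n c. \<forall>\<xi>. (\<exists>i<n. \<xi> i \<noteq> 0) \<longrightarrow>
        0 < (\<Sum>i<n. \<Sum>j<n. fundamental_tensor n (F \<circ> bundle_point n A c) i j z * \<xi> i * \<xi> j))"

definition weyl_metric :: "nat \<Rightarrow> 'a chart set \<Rightarrow> ('a \<times> 'a tvec \<Rightarrow> real) \<Rightarrow> bool" where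
  "weyl_metric n A F \<longleftrightarrow>
     finsler_metric n A F \<and>
     (\<forall>c\<in>A. \<forall>z\<in>TM0_coords n c. \<forall>i<n. \<forall>k<n. weyl n (F \<circ> bundle_point n A c) i k z = 0)"

definition smooth_scalar_on_TM :: "nat \<Rightarrow> 'a chart set \<Rightarrow> ('a \<times> 'a tvec \<Rightarrow> real) \<Rightarrow> bool" where
  "smooth_scalar_on_TM n A lam \<longleftrightarrow>
     (\<forall>c\<in>A. smooth_on (2 * n) (TM_coords n c) (lam \<circ> bundle_point n A c))"

text \<open>A tensor with components \<open>\<mu>\<^sub>r(x, y)\<close> assigns to every nonzero tangent vector v at p a
  linear form on the tangent space at p, smoothly in v.\<close>

definition covector_comp ::
    "nat \<Rightarrow> 'a chart set \<Rightarrow> 'a chart \<Rightarrow> ('a \<times> 'a tvec \<Rightarrow> 'a tvec \<Rightarrow> real)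
      \<Rightarrow> nat \<Rightarrow> (nat \<Rightarrow> real) \<Rightarrow> real" where
  "covector_comp n A c \<mu> r z =
     \<mu> (bundle_point n A c z) (coord_vec n A c (fst (bundle_point n A c z)) r)"

definition covector_on_TM0 ::
    "nat \<Rightarrow> 'a chart set \<Rightarrow> ('a \<times> 'a tvec \<Rightarrow> 'a tvec \<Rightarrow> real) \<Rightarrow> bool" where
  "covector_on_TM0 n A \<mu> \<longleftrightarrow>
     (\<forall>v \<in> slit_tangent_bundle n A.
        \<forall>X \<in> tangent_space n A (fst v). \<forall>Y \<in> tangent_space n A (fst v). \<forall>a b.
          \<mu> v (\<lambda>f. a * X f + b * Y f) = a * \<mu> v X + b * \<mu> v Y) \<and>
     (\<forall>c\<in>A. \<forall>r<n. smooth_on (2 * n) (TM0_coords n c) (covector_comp n A c \<mu> r))"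

definition generalized_weakly_weyl_metric ::
    "nat \<Rightarrow> 'a chart set \<Rightarrow> ('a \<times> 'a tvec \<Rightarrow> real) \<Rightarrow> bool" where
  "generalized_weakly_weyl_metric n A F \<longleftrightarrow>
     finsler_metric n A F \<and>
     (\<exists>lam \<mu>. smooth_scalar_on_TM n A lam \<and> covector_on_TM0 n A \<mu> \<and>
        (\<forall>c\<in>A. let L = F \<circ> bundle_point n A c in
           \<forall>z\<in>TM0_coords n c. \<forall>j<n. \<forall>i<n. \<forall>k<n. \<forall>l<n.
             weyl_tilde_hcov0 n L j i k l z
               + lam (bundle_point n A c z) * L z * weyl_tilde n L j i k l z
             = (\<Sum>r<n. covector_comp n A c \<mu> r z * weyl_tilde n L j r k l z) * z (n + i)))"

end

theory Submission
  imports Defs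
begin

text \<open>If W vanishes, so does every term of the defining equation of generalized weakly-Weyl
  metrics, with zero \<open>\<lambda>\<close> and \<open>\<mu>\<close>.  For a Riemannian metric the spray is quadratic in y, hence so
  is W, and the third y-derivatives of W that make up W-tilde vanish.  A Riemannian metric of
  non-constant sectional curvature is therefore a separating example; here it is
  \<open>dx\<^sub>0\<^sup>2 + dx\<^sub>1\<^sup>2 + exp (2 x\<^sub>0) dx\<^sub>2\<^sup>2\<close>, the product of a hyperbolic plane and a line.\<close>

section \<open>Partial derivatives\<close>

text \<open>\<open>partial\<close> rests on \<open>deriv\<close>, which returns some value even
  where no derivative exists. This predicate also asserts existence, so that the sum, product and
  chain rules compose.\<close>

definition has_partial :: "nat \<Rightarrow> ((nat \<Rightarrow> real) \<Rightarrow> real) \<Rightarrow> real \<Rightarrow> (nat \<Rightarrow> real) \<Rightarrow> bool" where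
  "has_partial i f d x \<longleftrightarrow> ((\<lambda>t. f (x(i := t))) has_real_derivative d) (at (x i))"

lemma has_partial_imp_partial: "has_partial i f d x \<Longrightarrow> partial i f x = d"
  unfolding has_partial_def partial_def by (rule DERIV_imp_deriv)

lemma partial_const [simp]: "partial i (\<lambda>x. c) = (\<lambda>x. 0)"
  by (simp add: partial_def fun_eq_iff)

lemma has_partial_const: "has_partial i (\<lambda>x. c) 0 x"
  by (simp add: has_partial_def)

lemma has_partial_coord: "has_partial i (\<lambda>x. x j) (of_bool (i = j)) x"
  by (auto simp: has_partial_def)

lemma has_partial_add:
  "has_partial i f d x \<Longrightarrow> has_partial i g e x \<Longrightarrow> has_partial i (\<lambda>x. f x + g x) (d + e) x"
  unfolding has_partial_def by (rule DERIV_add)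

lemma has_partial_mult:
  assumes "has_partial i f d x" "has_partial i g e x"
  shows "has_partial i (\<lambda>x. f x * g x) (d * g x + e * f x) x"
  using DERIV_mult[OF assms[unfolded has_partial_def]] by (simp add: has_partial_def)

lemma has_partial_chain:
  assumes "has_partial i f d x" "(h has_real_derivative e) (at (f x))"
  shows "has_partial i (\<lambda>x. h (f x)) (e * d) x"
  using DERIV_chain2[where f=h and g="\<lambda>t. f (x(i := t))" and x="x i"] assms
  by (simp add: has_partial_def)

text \<open>Openness along coordinate lines only: a partial derivative at a point sees nothing but
  the values on one such line. This is all that locality needs, and it is easier to establish for
  induced bundle coordinates than openness.\<close>

definition coord_open :: "nat \<Rightarrow> (nat \<Rightarrow> real) set \<Rightarrow> bool" where
  "coord_open m S \<longleftrightarrow> (\<forall>x\<in>S. \<forall>i<m. \<forall>\<^sub>F t in nhds (x i). x(i := t) \<in> S)"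

lemma tendsto_fun_upd: "((\<lambda>t. x(i := t)) \<longlongrightarrow> (x :: nat \<Rightarrow> real)) (nhds (x i))"
proof -
  have "continuous_on UNIV (\<lambda>t. x(i := t))"
  proof (rule continuous_on_coordinatewise_then_product)
    show "continuous_on UNIV (\<lambda>t. (x(i := t)) j)" for j
      by (cases "j = i") auto
  qed
  then have "isCont (\<lambda>t. x(i := t)) (x i)"
    by (simp add: continuous_on_eq_continuous_at)
  then show ?thesis
    by (simp add: isCont_def tendsto_nhds_iff)
qed

lemma coord_open_openin:
  assumes "openin (Euclidean_space m) S"
  shows "coord_open m S"
proof -
  obtain T where T: "open T" "S = T \<inter> {x. \<forall>i\<ge>m. x i = 0}"
    using assms by (auto simp: Euclidean_space_def openin_subtopology euclidean_product_topology)
  show ?thesis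
    unfolding coord_open_def
  proof (intro ballI allI impI)
    fix x i assume x: "x \<in> S" and i: "i < m"
    have "\<forall>\<^sub>F t in nhds (x i). x(i := t) \<in> T"
      using topological_tendstoD[OF tendsto_fun_upd[of x i] T(1)] x T(2) by auto
    then show "\<forall>\<^sub>F t in nhds (x i). x(i := t) \<in> S"
      by (rule eventually_mono) (use x i T(2) in auto)
  qed
qed

lemma has_partial_cong_on:
  assumes "coord_open m S" "x \<in> S" "i < m" and eq: "\<And>z. z \<in> S \<Longrightarrow> f z = g z"
  shows "has_partial i f d x \<longleftrightarrow> has_partial i g d x"
proof -
  have "\<forall>\<^sub>F t in nhds (x i). x(i := t) \<in> S"
    using assms by (auto simp: coord_open_def)
  then have "\<forall>\<^sub>F t in nhds (x i). f (x(i := t)) = g (x(i := t))"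
    by (rule eventually_mono) (use eq in auto)
  then show ?thesis
    unfolding has_partial_def by (intro DERIV_cong_ev) auto
qed

lemma partial_cong_on:
  assumes "coord_open m S" "x \<in> S" "i < m" and "\<And>z. z \<in> S \<Longrightarrow> f z = g z"
  shows "partial i f x = partial i g x"
  \<comment> \<open>\<open>deriv\<close> is a choice among the numbers that are derivatives. Both
    functions have the same ones, so the equation holds even where there are none.\<close>
  using has_partial_cong_on[where f=f and g=g, OF assms]
  by (auto simp: has_partial_def partial_def deriv_def)

lemma partial_zero_on:
  assumes "coord_open m S" "x \<in> S" "i < m" and "\<And>z. z \<in> S \<Longrightarrow> f z = 0"
  shows "partial i f x = 0"
  using partial_cong_on[OF assms(1-3), of f "\<lambda>z. 0"] assms(4) by simp

text \<open>Replaces the quantifier over all iterated partials by an invariant: a class of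
  continuous functions closed under partials on S contains every iterated partial up to equality on
  S. Only the members of the class have to be differentiated.\<close>

lemma smooth_on_if_closed_class:
  assumes op: "coord_open m S" and f: "g0 \<in> C" "\<And>x. x \<in> S \<Longrightarrow> f x = g0 x"
    and cont: "\<And>g. g \<in> C \<Longrightarrow> continuous_on S g"
    and der: "\<And>g i. g \<in> C \<Longrightarrow> i < m \<Longrightarrow> \<exists>h\<in>C. \<forall>x\<in>S. has_partial i g (h x) x"
  shows "smooth_on m S f"
proof -
  have iter: "\<exists>g\<in>C. \<forall>x\<in>S. foldr partial ks f x = g x" if "set ks \<subseteq> {..<m}" for ks
    using that
  proof (induction ks)
    case Nil
    then show ?case using f by auto
  next
    case (Cons i ks)
    then obtain g where g: "g \<in> C" "\<forall>x\<in>S. foldr partial ks f x = g x" by auto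
    obtain h where h: "h \<in> C" "\<forall>x\<in>S. has_partial i g (h x) x"
      using der[OF g(1), of i] Cons.prems by auto
    have "foldr partial (i # ks) f x = h x" if "x \<in> S" for x
      using partial_cong_on[OF op that, of i "foldr partial ks f" g] g(2) h(2) that Cons.prems
      by (simp add: has_partial_imp_partial)
    then show ?case using h(1) by blast
  qed
  show ?thesis
    unfolding smooth_on_def
  proof (intro allI impI conjI ballI)
    fix ks assume ks: "set ks \<subseteq> {..<m}"
    obtain g where g: "g \<in> C" "\<forall>x\<in>S. foldr partial ks f x = g x" using iter[OF ks] by auto
    show "continuous_on S (foldr partial ks f)"
      using cont[OF g(1)] g(2) continuous_on_cong by metis
    fix x i assume x: "x \<in> S" "i < m"
    obtain h where "\<forall>x\<in>S. has_partial i g (h x) x" using der[OF g(1) x(2)] by auto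
    then have "has_partial i (foldr partial ks f) (h x) x"
      using has_partial_cong_on[OF op x, of "foldr partial ks f" g] g(2) x by auto
    then show "(\<lambda>t. foldr partial ks f (x(i := t))) differentiable at (x i)"
      unfolding has_partial_def real_differentiable_def by blast
  qed
qed

lemma smooth_on_affine:
  assumes op: "coord_open m S" and f: "\<And>x. x \<in> S \<Longrightarrow> f x = a * x i + b"
  shows "smooth_on m S f"
proof (rule smooth_on_if_closed_class[OF op, where C = "{\<lambda>x. a * x j + b | a b j. True}"])
  show "(\<lambda>x. a * x i + b) \<in> {\<lambda>x. a * x j + b | a b j. True}" by blast
  fix g :: "(nat \<Rightarrow> real) \<Rightarrow> real" assume "g \<in> {\<lambda>x. a * x j + b | a b j. True}"
  then obtain a b j where g: "g = (\<lambda>x. a * x j + b)" by blast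
  show "continuous_on S g"
    unfolding g
    by (intro continuous_intros continuous_on_subset[OF continuous_on_product_coordinates]) auto
  fix k
  have "has_partial k g (0 * x j + of_bool (k = j) * a + 0) x" for x
    unfolding g by (intro has_partial_add has_partial_mult has_partial_const has_partial_coord)
  \<comment> \<open>The derivative is constant; slope 0 brings it back into the affine
    class.\<close>
  then have "\<forall>x\<in>S. has_partial k g (0 * x 0 + of_bool (k = j) * a) x" by simp
  then show "\<exists>h\<in>{\<lambda>x. a * x j + b | a b j. True}. \<forall>x\<in>S. has_partial k g (h x) x"
    by (intro bexI[where x = "\<lambda>x. 0 * x 0 + of_bool (k = j) * a"]) blast+
qed (use f in auto)


section \<open>Weyl metrics\<close>

text \<open>Varying a base coordinate moves \<open>base_coords\<close> along the same line inside
  the open chart image; varying a fibre coordinate leaves it fixed.\<close>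

lemma coord_open_TM_coords:
  assumes "openin (Euclidean_space n) (chart_image c)"
  shows "coord_open (2 * n) (TM_coords n c)"
  unfolding coord_open_def
proof (intro ballI allI impI)
  fix z i assume z: "z \<in> TM_coords n c" and i: "i < 2 * n"
  have "\<forall>\<^sub>F t in nhds (z i). base_coords n (z(i := t)) \<in> chart_image c"
  proof (cases "i < n")
    case True
    have eq: "base_coords n (z(i := t)) = (base_coords n z)(i := t)" for t
      using True by (auto simp: base_coords_def)
    have "base_coords n z i = z i" "base_coords n z \<in> chart_image c"
      using True z by (auto simp: base_coords_def TM_coords_def)
    then show ?thesis
      using coord_open_openin[OF assms] True unfolding eq coord_open_def by metis
  next
    case False
    then have "base_coords n (z(i := t)) = base_coords n z" for t
      by (auto simp: base_coords_def)
    then show ?thesis using z by (simp add: TM_coords_def)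
  qed
  then show "\<forall>\<^sub>F t in nhds (z i). z(i := t) \<in> TM_coords n c"
    by (rule eventually_mono) (use z i in \<open>auto simp: TM_coords_def topspace_Euclidean_space\<close>)
qed

lemma coord_open_TM0_coords:
  assumes "openin (Euclidean_space n) (chart_image c)"
  shows "coord_open (2 * n) (TM0_coords n c)"
  unfolding coord_open_def
proof (intro ballI allI impI)
  fix z i assume z: "z \<in> TM0_coords n c" and i: "i < 2 * n"
  obtain j where j: "j < n" "z (n + j) \<noteq> 0" using z by (auto simp: TM0_coords_def)
  have "isCont (\<lambda>z. z (n + j)) z"
    by (rule continuous_on_interior[OF continuous_on_product_coordinates]) simp
  then have "((\<lambda>t. (z(i := t)) (n + j)) \<longlongrightarrow> z (n + j)) (nhds (z i))"
    using tendsto_fun_upd[of z i] isCont_tendsto_compose by blast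
  then have "\<forall>\<^sub>F t in nhds (z i). (z(i := t)) (n + j) \<noteq> 0"
    using j(2) by (rule tendsto_imp_eventually_ne)
  moreover have "\<forall>\<^sub>F t in nhds (z i). z(i := t) \<in> TM_coords n c"
    using coord_open_TM_coords[OF assms] z i by (auto simp: coord_open_def TM0_coords_def)
  ultimately show "\<forall>\<^sub>F t in nhds (z i). z(i := t) \<in> TM0_coords n c"
    by eventually_elim (use j in \<open>unfold TM0_coords_def, blast\<close>)
qed

text \<open>W is known to vanish on S only, so each of the three fibre derivatives is taken by
  locality on the coordinate-open set.\<close>

lemma weyl_tilde_eq_0_if_weyl_eq_0:
  assumes op: "coord_open (2 * n) S"
    and W: "\<And>z i k. z \<in> S \<Longrightarrow> i < n \<Longrightarrow> k < n \<Longrightarrow> weyl n L i k z = 0"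
    and *: "z \<in> S" "j < n" "i < n" "k < n" "l < n"
  shows "weyl_tilde n L j i k l z = 0"
proof -
  have "partial (n + k) (weyl n L i l) z = 0" if "z \<in> S" "i < n" "k < n" "l < n" for i k l z
    by (rule partial_zero_on[OF op]) (use that W in auto)
  then have "weyl4 n L j i k l z = 0" if "z \<in> S" "i < n" "j < n" "k < n" "l < n" for j i k l z
    unfolding weyl4_def using that by (intro partial_zero_on[OF op]) auto
  then have "partial (n + k) (weyl4 n L j i m l) z = 0" if "m < n" for m
    using that * by (intro partial_zero_on[OF op]) auto
  then show ?thesis
    by (simp add: weyl_tilde_def)
qed

text \<open>The Berwald derivative is linear in the components of the tensor and their partials. The
  latter vanish at z because the components vanish on all of S.\<close>

lemma weyl_tilde_hcov0_eq_0:
  assumes op: "coord_open (2 * n) S"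
    and W: "\<And>z j i k l. z \<in> S \<Longrightarrow> j < n \<Longrightarrow> i < n \<Longrightarrow> k < n \<Longrightarrow> l < n \<Longrightarrow>
      weyl_tilde n L j i k l z = 0"
    and *: "z \<in> S" "j < n" "i < n" "k < n" "l < n"
  shows "weyl_tilde_hcov0 n L j i k l z = 0"
proof -
  have "partial m (weyl_tilde n L j i k l) z = 0" if "m < 2 * n" for m
    by (rule partial_zero_on[OF op]) (use that W * in auto)
  then have "hcov n L (weyl_tilde n L) j i k l m z = 0" if "m < n" for m
    using that * W by (simp add: hcov_def)
  then show ?thesis
    by (simp add: weyl_tilde_hcov0_def)
qed

text \<open>Serves both halves of the theorem. The manifold hypothesis supplies the open chart
  images on which to differentiate.\<close>

lemma generalized_weakly_weyl_if_weyl_tilde_eq_0: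
  assumes M: "smooth_manifold n M A" and F: "finsler_metric n A F"
    and W: "\<And>c z j i k l. c \<in> A \<Longrightarrow> z \<in> TM0_coords n c \<Longrightarrow> j < n \<Longrightarrow> i < n \<Longrightarrow> k < n \<Longrightarrow> l < n \<Longrightarrow>
      weyl_tilde n (F \<circ> bundle_point n A c) j i k l z = 0"
  shows "generalized_weakly_weyl_metric n A F"
proof -
  have op: "openin (Euclidean_space n) (chart_image c)" if "c \<in> A" for c
    using M that by (auto simp: smooth_manifold_def)
  have "smooth_scalar_on_TM n A (\<lambda>v. 0)"
    unfolding smooth_scalar_on_TM_def
    by (auto intro!: smooth_on_affine[where a = 0 and b = 0] coord_open_TM_coords op)
  moreover have "covector_on_TM0 n A (\<lambda>v X. 0)"
    unfolding covector_on_TM0_def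
    by (auto simp: covector_comp_def
        intro!: smooth_on_affine[where a = 0 and b = 0] coord_open_TM0_coords op)
  moreover have "weyl_tilde_hcov0 n (F \<circ> bundle_point n A c) j i k l z = 0"
    if "c \<in> A" "z \<in> TM0_coords n c" "j < n" "i < n" "k < n" "l < n" for c z j i k l
    by (rule weyl_tilde_hcov0_eq_0[OF coord_open_TM0_coords[OF op]]) (use that W in auto)
  ultimately show ?thesis
    unfolding generalized_weakly_weyl_metric_def Let_def using F W
    by (intro conjI exI[of _ "\<lambda>v. 0"] exI[of _ "\<lambda>v X. 0"]) (auto simp: covector_comp_def)
qed

lemma weyl_imp_generalized_weakly_weyl:
  assumes M: "smooth_manifold n M A" and F: "weyl_metric n A F"
  shows "generalized_weakly_weyl_metric n A F"
proof (rule generalized_weakly_weyl_if_weyl_tilde_eq_0[OF M])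
  show "finsler_metric n A F" using F by (simp add: weyl_metric_def)
  fix c z j i k l
  assume *: "c \<in> A" "z \<in> TM0_coords n c" "j < n" "i < n" "k < n" "l < n"
  have "coord_open (2 * n) (TM0_coords n c)"
    using M * by (intro coord_open_TM0_coords) (auto simp: smooth_manifold_def)
  then show "weyl_tilde n (F \<circ> bundle_point n A c) j i k l z = 0"
    by (rule weyl_tilde_eq_0_if_weyl_eq_0) (use F * in \<open>auto simp: weyl_metric_def\<close>)
qed

section \<open>The product of a hyperbolic plane and a line\<close>

text \<open>The functions \<open>ypoly d\<close> are homogeneous of degree d in the fibre coordinates
  \<open>y\<^sup>i = z (3 + i)\<close>, with coefficients depending on \<open>x\<^sub>0\<close> only; the zero function has every degree.\<close>

inductive ypoly :: "nat \<Rightarrow> ((nat \<Rightarrow> real) \<Rightarrow> real) \<Rightarrow> bool" where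
  zero: "ypoly d (\<lambda>z. 0)"
| const: "ypoly 0 (\<lambda>z. c)"
| exp: "ypoly 0 (\<lambda>z. exp (2 * z 0))"
| fibre: "ypoly 1 (\<lambda>z. z (3 + i))"
| add: "ypoly d f \<Longrightarrow> ypoly d g \<Longrightarrow> ypoly d (\<lambda>z. f z + g z)"
| mult: "ypoly d f \<Longrightarrow> ypoly e g \<Longrightarrow> ypoly (d + e) (\<lambda>z. f z * g z)"

text \<open>The degree equation is a separate premise, so that a product can be split without
  unifying against a sum of degrees.\<close>

lemma ypoly_multI: "ypoly d f \<Longrightarrow> ypoly e g \<Longrightarrow> k = d + e \<Longrightarrow> ypoly k (\<lambda>z. f z * g z)"
  using ypoly.mult by blast

lemma ypoly_cmult: "ypoly d f \<Longrightarrow> ypoly d (\<lambda>z. c * f z)"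
  by (rule ypoly_multI[OF ypoly.const]) auto

lemma ypoly_diff:
  assumes "ypoly d f" "ypoly d g"
  shows "ypoly d (\<lambda>z. f z - g z)"
  using ypoly.add[OF assms(1) ypoly_cmult[OF assms(2), of "-1"]] by simp

lemma ypoly_sum:
  assumes "\<And>i. i \<in> I \<Longrightarrow> ypoly d (f i)"
  shows "ypoly d (\<lambda>z. \<Sum>i\<in>I. f i z)"
  using assms by (induction I rule: infinite_finite_induct) (auto intro: ypoly.zero ypoly.add)

lemma ypoly_has_partial_base:
  assumes "ypoly d f" "i < 3"
  shows "\<exists>g. ypoly d g \<and> (\<forall>z. has_partial i f (g z) z)"
  using assms
proof (induction rule: ypoly.induct)
  case exp
  have "has_partial i (\<lambda>z. exp (2 * z 0)) (of_bool (i = 0) * 2 * exp (2 * z 0)) z" for z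
    unfolding has_partial_def by (auto intro!: derivative_eq_intros)
  then show ?case
    by (intro exI[of _ "\<lambda>z. of_bool (i = 0) * 2 * exp (2 * z 0)"] conjI allI ypoly_cmult ypoly.exp)
next
  case (fibre j)
  then have "has_partial i (\<lambda>z. z (3 + j)) 0 z" for z
    using has_partial_coord[of i "3 + j" z] by simp
  then show ?case by (intro exI[of _ "\<lambda>z. 0"]) (auto intro: ypoly.zero)
next
  case (add d f g)
  then show ?case by (blast intro: ypoly.add has_partial_add)
next
  case (mult d f e g)
  then obtain f' g' where "ypoly d f'" "\<And>z. has_partial i f (f' z) z"
    "ypoly e g'" "\<And>z. has_partial i g (g' z) z" by blast
  with mult show ?case
    by (intro exI[of _ "\<lambda>z. f' z * g z + g' z * f z"])
      (auto intro!: ypoly.add has_partial_mult intro: ypoly_multI)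
qed (auto intro: ypoly.zero has_partial_const)

text \<open>On naturals \<open>d - 1\<close> is 0 for d = 0, which loses the fact that the
  derivative then vanishes. The extra clause keeps it, both for the product rule and for killing
  degree 0 later.\<close>

lemma ypoly_has_partial_fibre:
  assumes "ypoly d f" "3 \<le> i"
  shows "\<exists>g. ypoly (d - 1) g \<and> (d = 0 \<longrightarrow> g = (\<lambda>z. 0)) \<and> (\<forall>z. has_partial i f (g z) z)"
  using assms
proof (induction rule: ypoly.induct)
  case exp
  then have "has_partial i (\<lambda>z. exp (2 * z 0)) 0 z" for z
    unfolding has_partial_def by (auto intro!: derivative_eq_intros)
  then show ?case by (auto intro!: exI[of _ "\<lambda>z. 0"] ypoly.zero)
next
  case (fibre j)
  show ?case
    using has_partial_coord[of i "3 + j"]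
    by (intro exI[of _ "\<lambda>z. of_bool (i = 3 + j)"]) (auto intro: ypoly.const)
next
  case (add d f g)
  then obtain f' g' where "ypoly (d - 1) f'" "d = 0 \<longrightarrow> f' = (\<lambda>z. 0)"
    "\<And>z. has_partial i f (f' z) z" "ypoly (d - 1) g'" "d = 0 \<longrightarrow> g' = (\<lambda>z. 0)"
    "\<And>z. has_partial i g (g' z) z" by blast
  then show ?case
    by (intro exI[of _ "\<lambda>z. f' z + g' z"]) (auto intro: ypoly.add has_partial_add)
next
  case (mult d f e g)
  then obtain f' g' where f': "ypoly (d - 1) f'" "d = 0 \<longrightarrow> f' = (\<lambda>z. 0)"
    "\<And>z. has_partial i f (f' z) z" and g': "ypoly (e - 1) g'" "e = 0 \<longrightarrow> g' = (\<lambda>z. 0)"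
    "\<And>z. has_partial i g (g' z) z" by blast
  \<comment> \<open>For d = 0 the degree of the product would be e instead of e - 1; there the
    factor \<open>f'\<close> is the zero function, which has every degree.\<close>
  have "ypoly (d + e - 1) (\<lambda>z. f' z * g z)"
    using f' mult.hyps by (cases d) (auto intro: ypoly.zero ypoly_multI)
  moreover have "ypoly (d + e - 1) (\<lambda>z. g' z * f z)"
    using g' mult.hyps by (cases e) (auto intro: ypoly.zero ypoly_multI)
  ultimately show ?case
    using f' g'
    by (intro exI[of _ "\<lambda>z. f' z * g z + g' z * f z"])
      (auto intro: ypoly.add has_partial_mult)
qed (auto intro: ypoly.zero has_partial_const)

lemma ypoly_partial_base: "ypoly d f \<Longrightarrow> i < 3 \<Longrightarrow> ypoly d (partial i f)"
  using ypoly_has_partial_base has_partial_imp_partial by (metis ext)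

lemma ypoly_partial_fibre: "ypoly d f \<Longrightarrow> e = d - 1 \<Longrightarrow> ypoly e (partial (3 + i) f)"
  using ypoly_has_partial_fibre[of d f "3 + i"] has_partial_imp_partial by (metis ext le_add1)

lemma ypoly_0_partial_fibre: "ypoly 0 f \<Longrightarrow> partial (3 + i) f z = 0"
  using ypoly_has_partial_fibre[of 0 f "3 + i"] has_partial_imp_partial by fastforce

text \<open>Degree count: R, A and W keep degree 2, the two fibre derivatives in
  \<open>weyl4\<close> lower it to 0, and the third one gives 0.\<close>

lemma weyl_tilde_eq_0_if_spray_quadratic:
  assumes G: "\<And>i. i < 3 \<Longrightarrow> ypoly 2 (spray 3 L i)"
    and *: "j < 3" "i < 3" "k < 3" "l < 3"
  shows "weyl_tilde 3 L j i k l z = 0"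
proof -
  note yp = ypoly_partial_base ypoly_partial_fibre
  have R: "ypoly 2 (riemann 3 L i k)" if "i < 3" "k < 3" for i k
  proof -
    have "ypoly 2 (\<lambda>z. 2 * partial k (spray 3 L i) z
     - (\<Sum>m<3. partial m (partial (3 + k) (spray 3 L i)) z * z (3 + m))
     + 2 * (\<Sum>m<3. spray 3 L m z * partial (3 + m) (partial (3 + k) (spray 3 L i)) z)
     - (\<Sum>m<3. partial (3 + m) (spray 3 L i) z * partial (3 + k) (spray 3 L m) z))"
      \<comment> \<open>Degree 2 splits as 1 + 1 where y or two first fibre derivatives of the spray
        are multiplied, and as 2 + 0 for the spray times its second fibre derivative.\<close>
      by (intro ypoly_diff ypoly.add ypoly_cmult ypoly_sum
          ypoly_multI[where d=1 and e=1 and k=2] ypoly_multI[where d=2 and e=0 and k=2]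
          yp(1)[OF G] yp(1)[OF yp(2)[OF G]] yp(2)[OF yp(2)[OF G]] yp(2)[OF G] ypoly.fibre G)
        (use that in auto)
    then show ?thesis by (simp add: riemann_def[abs_def])
  qed
  have "ypoly 2 (ricci_scalar 3 L)"
    unfolding ricci_scalar_def[abs_def] by (intro ypoly_cmult ypoly_sum R) auto
  then have A: "ypoly 2 (A_tensor 3 L i k)" if "i < 3" "k < 3" for i k
    unfolding A_tensor_def[abs_def]
    by (intro ypoly_diff R that ypoly_multI[where d=2 and e=0] ypoly.const) auto
  have W: "ypoly 2 (weyl 3 L i k)" if "i < 3" "k < 3" for i k
    unfolding weyl_def[abs_def]
    by (intro ypoly_diff A that ypoly_multI[where d=1 and e=1 and k=2] ypoly_cmult ypoly_sum
        yp(2)[OF A] ypoly.fibre) (use that in auto)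
  have "ypoly 0 (weyl4 3 L j i m l)" if "m < 3" for m
    unfolding weyl4_def[abs_def]
    by (intro yp(2)[where d=1] ypoly_cmult ypoly_diff yp(2)[OF W]) (use * that in auto)
  then show ?thesis
    by (simp add: weyl_tilde_def ypoly_0_partial_fibre)
qed

section \<open>Metric tensor, spray and Weyl curvature of the example\<close>

definition hyp_energy :: "(nat \<Rightarrow> real) \<Rightarrow> real" where
  "hyp_energy z = (z 3)\<^sup>2 + (z 4)\<^sup>2 + exp (2 * z 0) * (z 5)\<^sup>2"

definition hyp_norm :: "(nat \<Rightarrow> real) \<Rightarrow> real" where
  "hyp_norm z = sqrt (hyp_energy z)"

text \<open>Metric tensor and spray involve only the square of the norm. The root, not
  differentiable at y = 0, thus drops out, and the formulas below hold at every z.\<close>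

lemma hyp_norm_square: "(\<lambda>z. (hyp_norm z)\<^sup>2) = hyp_energy"
  by (simp add: fun_eq_iff hyp_norm_def hyp_energy_def)

lemma partial_hyp_energy:
  "partial 0 hyp_energy = (\<lambda>z. 2 * exp (2 * z 0) * (z 5)\<^sup>2)"
  "partial (Suc 0) hyp_energy = (\<lambda>z. 0)"
  "partial 2 hyp_energy = (\<lambda>z. 0)"
  "partial 3 hyp_energy = (\<lambda>z. 2 * z 3)"
  "partial 4 hyp_energy = (\<lambda>z. 2 * z 4)"
  "partial 5 hyp_energy = (\<lambda>z. 2 * exp (2 * z 0) * z 5)"
  by (rule ext, rule has_partial_imp_partial, unfold has_partial_def hyp_energy_def,
      auto intro!: derivative_eq_intros)+

lemma partial_cmult_coord: "partial i (\<lambda>z. c * z j) = (\<lambda>z. c * of_bool (i = j))"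
  by (rule ext, rule has_partial_imp_partial, unfold has_partial_def)
    (auto intro!: derivative_eq_intros)

lemma partial_exp_coord:
  "partial i (\<lambda>z. 2 * exp (2 * z 0) * z 5) =
    (\<lambda>z. 4 * exp (2 * z 0) * z 5 * of_bool (i = 0) + 2 * exp (2 * z 0) * of_bool (i = 5))"
  by (rule ext, rule has_partial_imp_partial, unfold has_partial_def)
    (auto intro!: derivative_eq_intros)

lemma less_3_cases: "i < 3 \<Longrightarrow> i = 0 \<or> i = Suc 0 \<or> i = (2::nat)"
  by auto

lemma sum_less_3: "(\<Sum>i<3. f i) = f 0 + f (Suc 0) + (f 2 :: real)"
  by (simp add: numeral_3_eq_3 numeral_2_eq_2)

text \<open>The diagonal entry g_ii; the coordinates are orthogonal, so there are no others.\<close>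

definition hyp_tensor :: "nat \<Rightarrow> (nat \<Rightarrow> real) \<Rightarrow> real" where
  "hyp_tensor i z = (if i = 2 then exp (2 * z 0) else 1)"

lemma fundamental_tensor_hyp:
  assumes "i < 3" "j < 3"
  shows "fundamental_tensor 3 hyp_norm i j z = hyp_tensor i z * of_bool (i = j)"
  using less_3_cases[OF assms(1)] less_3_cases[OF assms(2)]
  by (auto simp: fundamental_tensor_def hyp_norm_square partial_hyp_energy partial_cmult_coord
      partial_exp_coord hyp_tensor_def)

text \<open>The definite description requires existence and uniqueness. Since g is diagonal, the
  matrix equation decouples into h_ij g_jj = delta_ij, which fixes each entry in range because g_jj
  is nonzero.\<close>

lemma inverse_tensor_hyp:
  assumes "i < 3" "j < 3"
  shows "inverse_tensor 3 hyp_norm i j z = of_bool (i = j) / hyp_tensor i z"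
proof -
  have pos: "hyp_tensor i z \<noteq> 0" for i by (simp add: hyp_tensor_def)
  have sum: "(\<Sum>l<3. h i l * fundamental_tensor 3 hyp_norm l j z) = h i j * hyp_tensor j z"
    if "j < 3" for h :: "nat \<Rightarrow> nat \<Rightarrow> real" and i j
    using less_3_cases[OF that] by (auto simp: sum_less_3 fundamental_tensor_hyp)
  have "(THE h. (\<forall>i j. 3 \<le> i \<or> 3 \<le> j \<longrightarrow> h i j = 0) \<and>
      (\<forall>i<3. \<forall>j<3. (\<Sum>l<3. h i l * fundamental_tensor 3 hyp_norm l j z) = of_bool (i = j)))
    = (\<lambda>i j. if i < 3 \<and> j < 3 then of_bool (i = j) / hyp_tensor i z else 0)" (is "The ?P = ?h")
  proof (rule the_equality)
    have "(\<Sum>l<3. ?h i l * fundamental_tensor 3 hyp_norm l j z) = of_bool (i = j)"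
      if "i < 3" "j < 3" for i j
      using that pos sum[OF that(2), of ?h i] by auto
    then show "?P ?h" by auto
    fix h assume h: "?P h"
    show "h = ?h"
    proof (intro ext)
      fix i j
      show "h i j = ?h i j"
      proof (cases "i < 3 \<and> j < 3")
        case True
        then have "h i j * hyp_tensor j z = of_bool (i = j)"
          using h by (auto simp: sum)
        then show ?thesis using pos[of j] True by (auto simp: field_simps)
      qed (use h in auto)
    qed
  qed
  then show ?thesis using assms by (simp add: inverse_tensor_def)
qed

text \<open>This is G^i = 1/2 Gamma^i_jk y^j y^k, where up to symmetry the only nonzero Christoffel
  symbols are Gamma^0_22 = - exp (2 x_0) and Gamma^2_02 = 1. Squares are written as products to
  match \<open>ypoly\<close>.\<close>

lemma spray_hyp:
  "spray 3 hyp_norm 0 = (\<lambda>z. - (1/2) * (exp (2 * z 0) * (z 5 * z 5)))"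
  "spray 3 hyp_norm (Suc 0) = (\<lambda>z. 0)"
  "spray 3 hyp_norm 2 = (\<lambda>z. z 3 * z 5)"
  by (simp_all add: fun_eq_iff spray_def sum_less_3 inverse_tensor_hyp hyp_norm_square
      partial_hyp_energy partial_cmult_coord partial_exp_coord hyp_tensor_def)
    (simp_all add: power2_eq_square)

lemma ypoly_coords: "ypoly 1 (\<lambda>z. z 3)" "ypoly 1 (\<lambda>z. z 4)" "ypoly 1 (\<lambda>z. z 5)"
  using ypoly.fibre[of 0] ypoly.fibre[of 1] ypoly.fibre[of 2] by simp_all

lemma ypoly_spray_hyp: "i < 3 \<Longrightarrow> ypoly 2 (spray 3 hyp_norm i)"
proof -
  have "ypoly 2 (\<lambda>z. - (1/2) * (exp (2 * z 0) * (z 5 * z 5)))"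
    by (intro ypoly_cmult ypoly_multI[where d=0 and e=2] ypoly.exp
        ypoly_multI[where d=1 and e=1] ypoly_coords) auto
  moreover have "ypoly 2 (\<lambda>z. z 3 * z 5)"
    by (intro ypoly_multI[where d=1 and e=1] ypoly_coords) auto
  ultimately show "i < 3 \<Longrightarrow> ypoly 2 (spray 3 hyp_norm i)"
    using less_3_cases[of i] by (auto simp: spray_hyp ypoly.zero)
qed

lemma ypoly_hyp_energy: "ypoly 2 hyp_energy"
  unfolding hyp_energy_def[abs_def] power2_eq_square
  by (intro ypoly.add ypoly_multI[where d=0 and e=2] ypoly.exp
      ypoly_multI[where d=1 and e=1] ypoly_coords) auto

lemma partial_spray_hyp_0:
  "partial i (spray 3 hyp_norm 0) =
    (\<lambda>z. - exp (2 * z 0) * (z 5 * z 5) * of_bool (i = 0) - exp (2 * z 0) * z 5 * of_bool (i = 5))"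
  unfolding spray_hyp
  by (rule ext, rule has_partial_imp_partial, unfold has_partial_def)
    (auto intro!: derivative_eq_intros)

lemma partial_spray_hyp_2:
  "partial i (spray 3 hyp_norm 2) = (\<lambda>z. z 5 * of_bool (i = 3) + z 3 * of_bool (i = 5))"
  unfolding spray_hyp
  by (rule ext, rule has_partial_imp_partial, unfold has_partial_def)
    (auto intro!: derivative_eq_intros)

lemma partial_spray_hyp_1: "partial i (spray 3 hyp_norm (Suc 0)) = (\<lambda>z. 0)"
  unfolding spray_hyp by simp

lemma partial_coord: "partial i (\<lambda>z. z j) = (\<lambda>z. of_bool (i = j))"
  using has_partial_coord has_partial_imp_partial by blast

text \<open>At \<open>y = \<partial>/\<partial>x\<^sup>0\<close> the flag curvatures in the directions \<open>\<partial>/\<partial>x\<^sup>1\<close> and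
  \<open>\<partial>/\<partial>x\<^sup>2\<close> are 0 and -1, which exhibits the non-constant curvature.\<close>

lemma weyl_hyp_nonzero:
  defines "z \<equiv> (\<lambda>i. of_bool (i = 3))"
  shows "weyl 3 hyp_norm 1 1 z \<noteq> 0"
proof -
  note ps = partial_spray_hyp_0 partial_spray_hyp_1 partial_spray_hyp_2
  \<comment> \<open>Here \<open>z 5 = 0\<close> and \<open>z 3 = 1\<close>; the only surviving term
    is the product - G^2_.2 G^2_.2 = - (y^0)^2 in R^2_2.\<close>
  have "riemann 3 hyp_norm 0 0 z = 0" "riemann 3 hyp_norm 1 1 z = 0" "riemann 3 hyp_norm 2 2 z = -1"
    by (simp_all add: riemann_def ps sum_less_3 partial_coord z_def) (simp_all add: spray_hyp)
  \<comment> \<open>The trace is -1, so R = -1/2 for n = 3, while R^1_1 = 0.\<close>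
  then have "A_tensor 3 hyp_norm 1 1 z = 1/2"
    by (simp add: A_tensor_def ricci_scalar_def sum_less_3)
  \<comment> \<open>The trace correction in W^1_1 carries the factor y^1 = \<open>z 4\<close> =
    0.\<close>
  then show ?thesis by (simp add: weyl_def z_def)
qed

section \<open>Smoothness of the norm away from the zero section\<close>

inductive smooth_alg :: "((nat \<Rightarrow> real) \<Rightarrow> real) \<Rightarrow> bool" where
  ypoly: "ypoly d f \<Longrightarrow> smooth_alg f"
| norm: "smooth_alg hyp_norm"
| inverse_norm: "smooth_alg (\<lambda>z. inverse (hyp_norm z))"
| add: "smooth_alg f \<Longrightarrow> smooth_alg g \<Longrightarrow> smooth_alg (\<lambda>z. f z + g z)"
| mult: "smooth_alg f \<Longrightarrow> smooth_alg g \<Longrightarrow> smooth_alg (\<lambda>z. f z * g z)"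

lemma ypoly_continuous_on: "ypoly d f \<Longrightarrow> continuous_on S f"
  by (induction rule: ypoly.induct)
    (auto intro!: continuous_intros intro: continuous_on_subset[OF continuous_on_product_coordinates])

lemma smooth_alg_continuous_on: "smooth_alg f \<Longrightarrow> continuous_on {z. 0 < hyp_energy z} f"
  by (induction rule: smooth_alg.induct)
    (auto intro: ypoly_continuous_on
      intro!: continuous_intros ypoly_continuous_on[OF ypoly_hyp_energy] simp: hyp_norm_def[abs_def])

text \<open>With E = F^2, the identities dF = dE / (2 F) and d(1/F) = - dF / F^2 explain why
  adjoining F and 1/F to the fibre polynomials already closes the algebra under partials where E >
  0.\<close>

lemma smooth_alg_has_partial:
  assumes "smooth_alg f"
  shows "\<exists>g. smooth_alg g \<and> (\<forall>z. 0 < hyp_energy z \<longrightarrow> has_partial i f (g z) z)"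
proof -
  have yp: "\<exists>g. smooth_alg g \<and> (\<forall>z. has_partial i f (g z) z)" if "ypoly d f" for d f
    using ypoly_has_partial_base[OF that, of i] ypoly_has_partial_fibre[OF that, of i]
    by (meson smooth_alg.ypoly not_le)
  obtain e where e: "smooth_alg e" "\<And>z. has_partial i hyp_energy (e z) z"
    using yp[OF ypoly_hyp_energy] by blast
  have const: "smooth_alg (\<lambda>z. c)" for c
    by (rule smooth_alg.ypoly[OF ypoly.const])
  let ?n = "\<lambda>z. (1/2) * inverse (hyp_norm z) * e z"
  have n: "smooth_alg ?n"
    by (intro smooth_alg.mult const e(1) smooth_alg.inverse_norm)
  have dn: "has_partial i hyp_norm (?n z) z" if "0 < hyp_energy z" for z
    using has_partial_chain[OF e(2) DERIV_real_sqrt[OF that]] by (simp add: hyp_norm_def[abs_def])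
  show ?thesis
    using assms
  proof (induction rule: smooth_alg.induct)
    case (ypoly d f)
    then show ?case using yp by blast
  next
    case norm
    show ?case using n dn by blast
  next
    case inverse_norm
    let ?m = "\<lambda>z. - 1 * (inverse (hyp_norm z) * inverse (hyp_norm z)) * ?n z"
    have "smooth_alg ?m"
      by (intro smooth_alg.mult const n smooth_alg.inverse_norm)
    moreover have "has_partial i (\<lambda>z. inverse (hyp_norm z)) (?m z) z" if "0 < hyp_energy z" for z
    proof -
      have "hyp_norm z \<noteq> 0" using that by (simp add: hyp_norm_def)
      from has_partial_chain[OF dn[OF that] DERIV_inverse[OF this]] show ?thesis
        by (simp add: power2_eq_square)
    qed
    ultimately show ?case by blast
  next
    case (add f g)
    then show ?case by (blast intro: smooth_alg.add has_partial_add)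
  next
    case (mult f g)
    then obtain f' g' where
      "smooth_alg f'" "\<And>z. 0 < hyp_energy z \<Longrightarrow> has_partial i f (f' z) z"
      "smooth_alg g'" "\<And>z. 0 < hyp_energy z \<Longrightarrow> has_partial i g (g' z) z" by blast
    with mult.hyps show ?case
      by (intro exI[of _ "\<lambda>z. f' z * g z + g' z * f z"])
        (auto intro: smooth_alg.add smooth_alg.mult has_partial_mult)
  qed
qed

section \<open>The example as a Finsler manifold with one global chart\<close>

definition hyp_atlas :: "(nat \<Rightarrow> real) chart set" where
  "hyp_atlas = {(topspace (Euclidean_space 3), id)}"

text \<open>Tangent vectors are derivations, so the components of a vector are its values on the
  coordinate functions.\<close>

definition hyp_metric :: "(nat \<Rightarrow> real) \<times> (nat \<Rightarrow> real) tvec \<Rightarrow> real" where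
  "hyp_metric v = sqrt ((snd v (\<lambda>q. q 0))\<^sup>2 + (snd v (\<lambda>q. q 1))\<^sup>2
     + exp (2 * fst v 0) * (snd v (\<lambda>q. q 2))\<^sup>2)"

lemma second_countable_euclidean:
  "second_countable (euclidean :: 'a :: second_countable_topology topology)"
proof -
  obtain B :: "'a set set" where B: "countable B" "topological_basis B"
    using ex_countable_basis by blast
  then show ?thesis
    unfolding second_countable_def
    by (metis open_openin topological_basisE topological_basis_open)
qed

lemma second_countable_Euclidean_space: "second_countable (Euclidean_space n)"
  unfolding Euclidean_space_def euclidean_product_topology
  by (intro second_countable_subtopology second_countable_euclidean)

lemma Hausdorff_Euclidean_space: "Hausdorff_space (Euclidean_space n)"
  unfolding Euclidean_space_def euclidean_product_topology
  by (intro Hausdorff_space_subtopology Hausdorff_space_euclidean)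

lemma chart_inv_id: "x \<in> S \<Longrightarrow> inv_into S id x = x"
  using inv_into_f_f[of id S x] by simp

lemma smooth_manifold_hyp: "smooth_manifold 3 (Euclidean_space 3) hyp_atlas"
  unfolding smooth_manifold_def
  by (auto simp: hyp_atlas_def Hausdorff_Euclidean_space second_countable_Euclidean_space
      chart_inv_id coord_open_openin
      intro!: homeomorphic_map_id[THEN iffD2] smooth_on_affine[where a = 1 and b = 0])

text \<open>Needed because \<open>coord_vec\<close> is 0 by convention on functions that are not
  smooth.\<close>

lemma smooth_functions_coord: "(\<lambda>q. q j) \<in> smooth_functions 3 hyp_atlas"
  unfolding smooth_functions_def
  by (auto simp: hyp_atlas_def chart_inv_id coord_open_openin
      intro!: smooth_on_affine[where a = 1 and b = 0])

lemma hyp_metric_bundle_point: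
  assumes "c \<in> hyp_atlas"
  shows "hyp_metric \<circ> bundle_point 3 hyp_atlas c = hyp_norm"
proof
  fix z
  let ?p = "base_coords 3 z"
  let ?S = "topspace (Euclidean_space 3)"
  have c: "c = (?S, id)" using assms by (simp add: hyp_atlas_def)
  have p: "?p \<in> ?S" by (auto simp: base_coords_def topspace_Euclidean_space)
  have "coord_vec 3 hyp_atlas c ?p i (\<lambda>q. q j) = of_bool (i = j)" if "i < 3" for i j
  proof -
    \<comment> \<open>The inverse chart is the identity only on the chart domain, hence the appeal
      to locality.\<close>
    have "partial i ((\<lambda>q. q j) \<circ> inv_into ?S id) ?p = partial i (\<lambda>q. q j) ?p"
      by (rule partial_cong_on[OF coord_open_openin[OF openin_topspace] p that])
        (simp add: chart_inv_id)
    then show ?thesis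
      by (simp add: coord_vec_def smooth_functions_coord c partial_coord)
  qed
  then show "(hyp_metric \<circ> bundle_point 3 hyp_atlas c) z = hyp_norm z"
    using p by (simp add: hyp_metric_def hyp_norm_def hyp_energy_def bundle_point_def Let_def c
        chart_inv_id sum_less_3 base_coords_def)
qed

lemma finsler_metric_hyp: "finsler_metric 3 hyp_atlas hyp_metric"
  unfolding finsler_metric_def
proof (intro conjI ballI)
  fix v :: "(nat \<Rightarrow> real) \<times> (nat \<Rightarrow> real) tvec"
  show "0 \<le> hyp_metric v"
    by (simp add: hyp_metric_def)
  show "case v of (p, D) \<Rightarrow> \<forall>a>0. hyp_metric (p, \<lambda>f. a * D f) = a * hyp_metric (p, D)"
  proof (clarify)
    fix p D and a :: real assume "0 < a"
    \<comment> \<open>All three squares contribute the factor a^2, whose root is a since a >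
      0.\<close>
    have "hyp_metric (p, \<lambda>f. a * D f) = sqrt (a\<^sup>2 * ((D (\<lambda>q. q 0))\<^sup>2 + (D (\<lambda>q. q 1))\<^sup>2
     + exp (2 * p 0) * (D (\<lambda>q. q 2))\<^sup>2))"
      by (simp add: hyp_metric_def power_mult_distrib algebra_simps)
    then show "hyp_metric (p, \<lambda>f. a * D f) = a * hyp_metric (p, D)"
      using \<open>0 < a\<close> by (simp add: hyp_metric_def real_sqrt_mult)
  qed
next
  fix c assume c: "c \<in> hyp_atlas"
  have op: "coord_open (2 * 3) (TM0_coords 3 c)"
    by (rule coord_open_TM0_coords) (use c in \<open>auto simp: hyp_atlas_def\<close>)
  have pos: "TM0_coords 3 c \<subseteq> {z. 0 < hyp_energy z}"
  proof
    fix z assume "z \<in> TM0_coords 3 c"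
    then obtain i where "i < 3" "z (3 + i) \<noteq> 0" by (auto simp: TM0_coords_def)
    then have "z 3 \<noteq> 0 \<or> z 4 \<noteq> 0 \<or> z 5 \<noteq> 0"
      using less_3_cases[of i] by auto
    then show "z \<in> {z. 0 < hyp_energy z}"
      by (auto simp: hyp_energy_def add_pos_nonneg add_nonneg_pos)
  qed
  show "smooth_on (2 * 3) (TM0_coords 3 c) (hyp_metric \<circ> bundle_point 3 hyp_atlas c)"
    unfolding hyp_metric_bundle_point[OF c]
  proof (rule smooth_on_if_closed_class[OF op, where C = "Collect smooth_alg"])
    show "hyp_norm \<in> Collect smooth_alg" by (simp add: smooth_alg.norm)
    fix g i assume "g \<in> Collect smooth_alg"
    then show "continuous_on (TM0_coords 3 c) g"
      and "\<exists>h\<in>Collect smooth_alg. \<forall>x\<in>TM0_coords 3 c. has_partial i g (h x) x"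
      using smooth_alg_continuous_on continuous_on_subset[OF _ pos] smooth_alg_has_partial[of g i] pos
      by blast+
  qed simp
  fix z
  show "\<forall>\<xi>. (\<exists>i<3. \<xi> i \<noteq> 0) \<longrightarrow> 0 < (\<Sum>i<3. \<Sum>j<3.
      fundamental_tensor 3 (hyp_metric \<circ> bundle_point 3 hyp_atlas c) i j z * \<xi> i * \<xi> j)"
  proof (intro allI impI)
    fix \<xi> :: "nat \<Rightarrow> real" assume "\<exists>i<3. \<xi> i \<noteq> 0"
    then have "\<xi> 0 \<noteq> 0 \<or> \<xi> (Suc 0) \<noteq> 0 \<or> \<xi> 2 \<noteq> 0"
      using less_3_cases by metis
    then have "0 < \<xi> 0 * \<xi> 0 + \<xi> (Suc 0) * \<xi> (Suc 0) + exp (2 * z 0) * (\<xi> 2 * \<xi> 2)"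
      by (auto simp: add_pos_nonneg add_nonneg_pos simp flip: power2_eq_square)
    then show "0 < (\<Sum>i<3. \<Sum>j<3.
      fundamental_tensor 3 (hyp_metric \<circ> bundle_point 3 hyp_atlas c) i j z * \<xi> i * \<xi> j)"
      unfolding hyp_metric_bundle_point[OF c]
      by (simp add: sum_less_3 fundamental_tensor_hyp hyp_tensor_def mult.assoc)
  qed
qed

lemma not_weyl_metric_hyp: "\<not> weyl_metric 3 hyp_atlas hyp_metric"
proof
  let ?c = "(topspace (Euclidean_space 3), id) :: (nat \<Rightarrow> real) chart"
  let ?z = "(\<lambda>i. of_bool (i = 3)) :: nat \<Rightarrow> real"
  have c: "?c \<in> hyp_atlas" by (simp add: hyp_atlas_def)
  assume "weyl_metric 3 hyp_atlas hyp_metric"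
  moreover have "?z \<in> TM0_coords 3 ?c"
    by (auto simp: TM0_coords_def TM_coords_def topspace_Euclidean_space base_coords_def)
  ultimately have "weyl 3 hyp_norm 1 1 ?z = 0"
    using c hyp_metric_bundle_point[OF c] unfolding weyl_metric_def by fastforce
  then show False using weyl_hyp_nonzero by simp
qed

lemma generalized_weakly_weyl_hyp: "generalized_weakly_weyl_metric 3 hyp_atlas hyp_metric"
  by (rule generalized_weakly_weyl_if_weyl_tilde_eq_0[OF smooth_manifold_hyp finsler_metric_hyp])
    (simp add: hyp_metric_bundle_point weyl_tilde_eq_0_if_spray_quadratic ypoly_spray_hyp)

theorem corollary4p12:
  shows "(\<forall>n (M :: 'a topology) A F.
            2 \<le> n \<and> smooth_manifold n M A \<and> weyl_metric n A F
              \<longrightarrow> generalized_weakly_weyl_metric n A F) \<and>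
         (\<exists>n (M :: (nat \<Rightarrow> real) topology) A F.
            2 \<le> n \<and> smooth_manifold n M A \<and> generalized_weakly_weyl_metric n A F
              \<and> \<not> weyl_metric n A F)"
proof (intro conjI allI impI)
  show "generalized_weakly_weyl_metric n A F"
    if "2 \<le> n \<and> smooth_manifold n M A \<and> weyl_metric n A F" for n A F and M :: "'a topology"
    using that weyl_imp_generalized_weakly_weyl by blast
  \<comment> \<open>Dimension 3 is the least possible for a Riemannian example: on a surface R^i_k =
    K (F^2 delta^i_k - y^i y_k) with K depending on the point only, which forces W = 0.\<close>
  have "(2::nat) \<le> 3" by simp
  then show "\<exists>n (M :: (nat \<Rightarrow> real) topology) A F.
      2 \<le> n \<and> smooth_manifold n M A \<and> generalized_weakly_weyl_metric n A F \<and> \<not> weyl_metric n A F"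
    using smooth_manifold_hyp generalized_weakly_weyl_hyp not_weyl_metric_hyp by blast
qed

end
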